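(* Let $\mathcal{D}$ be a finite dataset in $\mathbb{H}_r$, $q\in\mathbb{H}_r$ a query, $c>1$, and $\mathcal{O}$ an exact Euclidean nearest neighbor oracle with query time $\mathcal{T}$ and space $\mathcal{S}$. Let $R_{initial}=d_H(q,n_E)$ and $L_{initial}$ be the initial non-zero upper and lower bounds on the hyperbolic distance from $q$ to its hyperbolic nearest neighbor, as set by Binary-Search-HyperbolicNN. Then Binary-Search-HyperbolicNN returns a $c$-approximate hyperbolic nearest neighbor of $q$ in at most $\log_2\left(\frac{\log(R_{initial}/L_{initial})}{\log c}\right)$ rounds. The total runtime is $\mathcal{T}\cdot\log_2\left(\frac{\log(R_{initial}/L_{initial})}{\log c}\right)$ and the storage is $\mathcal{S}$.
   Context: $\mathbb{H}_r$ denotes the Poincaré ball model: the open unit ball of $\mathbb{R}^r$ with distance $d_H(x,y)=\operatorname{arccosh}\left(1+\frac{2\|x-y\|^2}{(1-\|x\|^2)(1-\|y\|^2)}\right)$. $\mathcal{B}_H(q,d)$ is the hyperbolic ball of center $q$ and radius $d$; it equals a Euclidean ball, whose Euclidean center we call the Euclidean center of $\mathcal{B}_H(q,d)$. A point $p\in\mathcal{D}$ is a $c$-approximate hyperbolic nearest neighbor of $q$ if $d_H(p,q)\le c\, d_H(p^*,q)$, where $p^*$ is a hyperbolic nearest neighbor of $q$ in $\mathcal{D}$. An exact Euclidean nearest neighbor oracle $\mathcal{O}$ returns, for a point $z$, an element $\mathcal{O}(z,\mathcal{D})\in\mathcal{D}$ minimizing Euclidean distance to $z$, in time $\mathcal{T}$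 and space $\mathcal{S}$. Binary-Search-HyperbolicNN: set $n_E\leftarrow\mathcal{O}(q,\mathcal{D})$, $n_H\leftarrow n_E$; if $n_E=q$ return $n_H$. Set $L=d_H\left(q,\left(1-\frac{\|n_E-q\|}{\|q\|}\right)q\right)$ and $R=d_H(n_E,q)$. While $R>cL$ (each iteration is a round): let $q_{new}$ be the Euclidean center of $\mathcal{B}_H(q,\sqrt{RL})$, set $n_E\leftarrow\mathcal{O}(q_{new},\mathcal{D})$; if $d_H(n_E,q)>\sqrt{RL}$ set $L\leftarrow\sqrt{RL}$, otherwise set $n_H\leftarrow n_E$ and $R\leftarrow d_H(n_H,q)$. Return $n_H$.
   Formalization: The round bound is rounded up to an integer (0 if negative), as the literal value can be below the rounds made; runtime is (T+a)(1+N), counting the initial oracle query, and storage S+w, with arbitrary overheads a, w (possibly 0); q=0 with n_E≠q, where L is undefined, is excluded. *)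

theory Defs
  imports "HOL-Analysis.Analysis" "HOL-Library.While_Combinator"
begin

text \<open>The Poincare ball of dimension \<open>DIM('a)\<close> is the open unit ball \<^term>\<open>ball 0 1\<close> of
  the Euclidean space \<open>'a\<close>.\<close>

definition dist_H :: "'a::euclidean_space \<Rightarrow> 'a \<Rightarrow> real" where
  "dist_H x y = arcosh (1 + 2 * (norm (x - y))\<^sup>2 / ((1 - (norm x)\<^sup>2) * (1 - (norm y)\<^sup>2)))"

definition ball_H :: "'a::euclidean_space \<Rightarrow> real \<Rightarrow> 'a set" where
  "ball_H q d = {x \<in> ball 0 1. dist_H q x \<le> d}"

definition euclidean_center_H :: "'a::euclidean_space \<Rightarrow> real \<Rightarrow> 'a" where
  "euclidean_center_H q d = (THE z. \<exists>s. ball_H q d = cball z s)"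

definition hyperbolic_nn :: "'a::euclidean_space \<Rightarrow> 'a set \<Rightarrow> 'a \<Rightarrow> bool" where
  "hyperbolic_nn q D p \<longleftrightarrow> p \<in> D \<and> (\<forall>x\<in>D. dist_H p q \<le> dist_H x q)"

definition approx_hyperbolic_nn :: "real \<Rightarrow> 'a::euclidean_space \<Rightarrow> 'a set \<Rightarrow> 'a \<Rightarrow> bool" where
  "approx_hyperbolic_nn c q D p \<longleftrightarrow>
     p \<in> D \<and> (\<exists>p'. hyperbolic_nn q D p' \<and> dist_H p q \<le> c * dist_H p' q)"

text \<open>Besides its answer, an oracle has a running time and a storage use for each query; the
  latter includes the data structure that the oracle keeps for the dataset.\<close>

record 'a nn_oracle =
  answer :: "'a \<Rightarrow> 'a set \<Rightarrow> 'a"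
  query_time :: "'a \<Rightarrow> 'a set \<Rightarrow> nat"
  query_storage :: "'a \<Rightarrow> 'a set \<Rightarrow> nat"

definition exact_euclidean_nn_oracle ::
    "'a::euclidean_space nn_oracle \<Rightarrow> 'a set \<Rightarrow> nat \<Rightarrow> nat \<Rightarrow> bool" where
  "exact_euclidean_nn_oracle orc D T S \<longleftrightarrow>
     (\<forall>z. answer orc z D \<in> D \<and> (\<forall>p\<in>D. dist z (answer orc z D) \<le> dist z p) \<and>
          query_time orc z D \<le> T \<and> query_storage orc z D \<le> S)"

definition R_initial :: "'a::euclidean_space nn_oracle \<Rightarrow> 'a \<Rightarrow> 'a set \<Rightarrow> real" where
  "R_initial orc q D = dist_H (answer orc q D) q"

text \<open>The argument of \<^const>\<open>dist_H\<close> is the point closest to the origin on the Euclidean sphere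
  around \<open>q\<close> through the Euclidean nearest neighbor. The formula is meant for \<open>q \<noteq> 0\<close>; for
  \<open>q = 0\<close> the conventions for division make it \<open>0\<close>.\<close>

definition L_initial :: "'a::euclidean_space nn_oracle \<Rightarrow> 'a \<Rightarrow> 'a set \<Rightarrow> real" where
  "L_initial orc q D = dist_H q ((1 - norm (answer orc q D - q) / norm q) *\<^sub>R q)"

text \<open>The fields \<open>rounds\<close>, \<open>time\<close> and \<open>storage\<close> only instrument the algorithm. Time accumulates
  and storage is a peak value. A query is charged what the oracle uses for it; in addition,
  the remaining operations of the initialization or of one round (a fixed number of operations on
  reals and points, with the loop test that follows) are charged \<open>a\<close> time units,
  and the program variables are charged \<open>w\<close> storage units. Charging oracle queries only
  is the instance \<open>a = 0\<close>, \<open>w = 0\<close>.\<close>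

record 'a search_state =
  lower :: real
  upper :: real
  best :: 'a
  rounds :: nat
  time :: nat
  storage :: nat

definition search_init ::
    "'a::euclidean_space nn_oracle \<Rightarrow> nat \<Rightarrow> nat \<Rightarrow> 'a \<Rightarrow> 'a set \<Rightarrow> 'a search_state" where
  "search_init orc a w q D =
     \<lparr>lower = L_initial orc q D, upper = R_initial orc q D, best = answer orc q D,
      rounds = 0, time = query_time orc q D + a, storage = query_storage orc q D + w\<rparr>"

definition search_round ::
    "'a::euclidean_space nn_oracle \<Rightarrow> nat \<Rightarrow> nat \<Rightarrow> 'a \<Rightarrow> 'a set \<Rightarrow> 'a search_state \<Rightarrow> 'a search_state"
  where
  "search_round orc a w q D s =
     (let d = sqrt (upper s * lower s);
          q_new = euclidean_center_H q d;
          n_E = answer orc q_new D;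
          s' = s\<lparr>rounds := rounds s + 1,
                 time := time s + query_time orc q_new D + a,
                 storage := max (storage s) (query_storage orc q_new D + w)\<rparr>
      in if dist_H n_E q > d then s'\<lparr>lower := d\<rparr>
         else s'\<lparr>best := n_E, upper := dist_H n_E q\<rparr>)"

text \<open>The result is \<^const>\<open>None\<close> iff the loop does not terminate; otherwise the returned point is
  the field \<^const>\<open>best\<close> of the final state.\<close>

definition binary_search_hyperbolic_nn ::
    "'a::euclidean_space nn_oracle \<Rightarrow> nat \<Rightarrow> nat \<Rightarrow> real \<Rightarrow> 'a \<Rightarrow> 'a set \<Rightarrow> 'a search_state option" where
  "binary_search_hyperbolic_nn orc a w c q D =
     (let s\<^sub>0 = search_init orc a w q D
      in if best s\<^sub>0 = q then Some s\<^sub>0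
         else while_option (\<lambda>s. upper s > c * lower s) (search_round orc a w q D) s\<^sub>0)"

text \<open>\<open>log\<^sub>2 (log (R / L) / log c)\<close> as a number of rounds: it is rounded up, and a negative value
  counts as 0. For \<open>R = L\<close>, where the expression would be minus infinity, the convention
  \<open>log 2 0 = 0\<close> also gives 0. If the Euclidean nearest neighbor is \<open>q\<close> itself, the search returns
  before the loop.\<close>

definition round_bound :: "'a::euclidean_space nn_oracle \<Rightarrow> real \<Rightarrow> 'a \<Rightarrow> 'a set \<Rightarrow> nat" where
  "round_bound orc c q D =
     (if answer orc q D = q then 0
      else nat \<lceil>log 2 (ln (R_initial orc q D / L_initial orc q D) / ln c)\<rceil>)"

end

theory Submission
  imports Defs
begin

text \<open>On the complement of a Euclidean ball around \<open>q\<close>, the hyperbolic distance to \<open>q\<close> is minimal at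
  the point of the sphere nearest to the origin, so the initial lower bound is valid. A hyperbolic
  ball is a Euclidean ball with another center, so the Euclidean nearest neighbor of that center
  decides whether the hyperbolic ball contains a data point; hence \<open>L\<close> and \<open>R\<close> stay lower and upper
  bounds. Testing the geometric mean of \<open>R\<close> and \<open>L\<close> at least halves \<open>ln (R / L)\<close> in each
  round.\<close>

section \<open>Elementary properties of the hyperbolic distance\<close>

lemma arcosh_le_arcosh:
  fixes x y :: real
  assumes "1 \<le> x" "x \<le> y"
  shows "arcosh x \<le> arcosh y"
proof -
  have "1 \<le> y" using assms by simp
  then have "\<not> arcosh y < arcosh x"
    using arcosh_less_iff_real[of y x] assms by simp
  then show ?thesis by simp
qed

lemma dist_H_commute: "dist_H x y = dist_H y x"
  by (simp add: dist_H_def norm_minus_commute mult.commute)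

lemma dist_H_self [simp]: "dist_H x x = 0"
  by (simp add: dist_H_def)

lemma one_minus_norm_sq_pos:
  fixes x :: "'a::euclidean_space"
  assumes "x \<in> ball 0 1"
  shows "0 < 1 - (norm x)\<^sup>2"
  using assms by (simp add: abs_square_less_1)

lemma dist_H_arg_ge_1:
  fixes x y :: "'a::euclidean_space"
  assumes "x \<in> ball 0 1" "y \<in> ball 0 1"
  shows "1 \<le> 1 + 2 * (norm (x - y))\<^sup>2 / ((1 - (norm x)\<^sup>2) * (1 - (norm y)\<^sup>2))"
  using one_minus_norm_sq_pos[OF assms(1)] one_minus_norm_sq_pos[OF assms(2)] by simp

lemma dist_H_nonneg:
  fixes x y :: "'a::euclidean_space"
  assumes "x \<in> ball 0 1" "y \<in> ball 0 1"
  shows "0 \<le> dist_H x y"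
  unfolding dist_H_def by (rule arcosh_nonneg_real[OF dist_H_arg_ge_1[OF assms]])

section \<open>Hyperbolic balls as Euclidean balls\<close>

lemma dist_H_le_iff:
  fixes q x :: "'a::euclidean_space"
  assumes q: "q \<in> ball 0 1" and x: "x \<in> ball 0 1" and "0 \<le> d"
  shows "dist_H q x \<le> d \<longleftrightarrow>
    (norm (x - q))\<^sup>2 \<le> (cosh d - 1) * (1 - (norm q)\<^sup>2) / 2 * (1 - (norm x)\<^sup>2)"
proof -
  let ?A = "1 + 2 * (norm (q - x))\<^sup>2 / ((1 - (norm q)\<^sup>2) * (1 - (norm x)\<^sup>2))"
  have "dist_H q x \<le> d \<longleftrightarrow> cosh (dist_H q x) \<le> cosh d"
    using cosh_real_nonneg_le_iff[OF dist_H_nonneg[OF q x] \<open>0 \<le> d\<close>] by simp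
  also have "cosh (dist_H q x) = ?A"
    unfolding dist_H_def using cosh_arcosh_real[OF dist_H_arg_ge_1[OF q x]] .
  also have "?A \<le> cosh d \<longleftrightarrow>
      (norm (x - q))\<^sup>2 \<le> (cosh d - 1) * (1 - (norm q)\<^sup>2) / 2 * (1 - (norm x)\<^sup>2)"
  proof -
    have "?A \<le> cosh d \<longleftrightarrow>
        2 * (norm (x - q))\<^sup>2 / ((1 - (norm q)\<^sup>2) * (1 - (norm x)\<^sup>2)) \<le> cosh d - 1"
      by (auto simp: norm_minus_commute)
    also have "\<dots> \<longleftrightarrow>
        2 * (norm (x - q))\<^sup>2 \<le> (cosh d - 1) * ((1 - (norm q)\<^sup>2) * (1 - (norm x)\<^sup>2))"
      using one_minus_norm_sq_pos[OF q] one_minus_norm_sq_pos[OF x]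
      by (intro pos_divide_le_eq mult_pos_pos)
    finally show ?thesis by (simp add: mult_ac)
  qed
  finally show ?thesis .
qed

text \<open>By \<open>dist_H_le_iff\<close>, membership is a quadratic inequality in
  \<open>x\<close> with leading coefficient \<open>1 + k\<close>. Completing the square gives the
  center \<open>q /\<^sub>R (1 + k)\<close>.\<close>

lemma ball_H_eq_cball:
  fixes q :: "'a::euclidean_space"
  assumes q: "q \<in> ball 0 1" and d: "0 \<le> d"
  shows "\<exists>z s. ball_H q d = cball z s"
proof -
  define k where "k = (cosh d - 1) * (1 - (norm q)\<^sup>2) / 2"
  have k: "0 \<le> k"
    using one_minus_norm_sq_pos[OF q] cosh_real_ge_1[of d] by (simp add: k_def)
  \<comment> \<open>The squared radius: the constant term after division by \<open>1 + k\<close>,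
    plus the squared norm of the center.\<close>
  define s2 where "s2 = (k - (norm q)\<^sup>2) / (1 + k) + (norm q)\<^sup>2 / (1 + k)\<^sup>2"
  have "(k - (norm q)\<^sup>2) / (1 + k) = (k - (norm q)\<^sup>2) * (1 + k) / (1 + k)\<^sup>2"
    using k by (simp add: power2_eq_square)
  then have "s2 = k * (k + (1 - (norm q)\<^sup>2)) / (1 + k)\<^sup>2"
    by (simp add: s2_def add_divide_distrib[symmetric] algebra_simps)
  then have s2: "0 \<le> s2"
    using k one_minus_norm_sq_pos[OF q] by simp
  have complete_square: "(norm (x - q))\<^sup>2 \<le> k * (1 - (norm x)\<^sup>2)
      \<longleftrightarrow> dist (q /\<^sub>R (1 + k)) x \<le> sqrt s2" for x
  proof -
    have "(dist (q /\<^sub>R (1 + k)) x)\<^sup>2 - s2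
        = ((norm (x - q))\<^sup>2 - k * (1 - (norm x)\<^sup>2)) / (1 + k)"
    proof -
      \<comment> \<open>Replacing division by \<open>u\<close> makes the identity polynomial modulo
        \<open>u * (1 + k) = 1\<close>, a form that \<open>algebra\<close> decides.\<close>
      define u where "u = 1 / (1 + k)"
      have u: "u * (1 + k) = 1" "u * u * (1 + k) = u"
        using k by (simp_all add: u_def)
      have "(dist (q /\<^sub>R (1 + k)) x)\<^sup>2 = (u *\<^sub>R q - x) \<bullet> (u *\<^sub>R q - x)"
        by (simp add: u_def dist_norm power2_norm_eq_inner inverse_eq_divide)
      moreover have "s2 = u * (k - q \<bullet> q) + u\<^sup>2 * (q \<bullet> q)"
        by (simp add: s2_def u_def power2_norm_eq_inner power_divide)
      ultimately have "(dist (q /\<^sub>R (1 + k)) x)\<^sup>2 - s2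
          = (u\<^sup>2 * (q \<bullet> q) - 2 * u * (x \<bullet> q) + x \<bullet> x) - (u * (k - q \<bullet> q) + u\<^sup>2 * (q \<bullet> q))"
        by (simp add: inner_diff_left inner_diff_right inner_commute power2_eq_square algebra_simps)
      also have "\<dots> = u * (q \<bullet> q - 2 * (x \<bullet> q) + x \<bullet> x - k * (1 - x \<bullet> x))"
        using u by algebra
      also have "\<dots> = ((norm (x - q))\<^sup>2 - k * (1 - (norm x)\<^sup>2)) / (1 + k)"
        by (simp add: u_def power2_norm_eq_inner inner_diff_left inner_diff_right inner_commute)
      finally show ?thesis .
    qed
    then have "(norm (x - q))\<^sup>2 \<le> k * (1 - (norm x)\<^sup>2) \<longleftrightarrow> (dist (q /\<^sub>R (1 + k)) x)\<^sup>2 \<le> s2"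
      using k by (smt (verit) divide_le_0_iff)
    also have "\<dots> \<longleftrightarrow> dist (q /\<^sub>R (1 + k)) x \<le> sqrt s2"
      using s2 by (metis real_le_rsqrt real_sqrt_le_iff real_sqrt_unique zero_le_dist)
    finally show ?thesis .
  qed
  \<comment> \<open>\<open>ball_H\<close> keeps only points of the unit ball, so the quadratic
    inequality must exclude all others: outside, its right side is at most 0, which forces
    \<open>x = q\<close>.\<close>
  have in_ball: "x \<in> ball 0 1" if "(norm (x - q))\<^sup>2 \<le> k * (1 - (norm x)\<^sup>2)" for x
  proof (rule ccontr)
    assume "x \<notin> ball 0 1"
    then have "1 \<le> norm x" by simp
    then have "1 - (norm x)\<^sup>2 \<le> 0" by simp
    then have "k * (1 - (norm x)\<^sup>2) \<le> 0"
      using k by (simp add: mult_nonneg_nonpos)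
    with that have "x = q"
      by (smt (verit) norm_eq_zero power2_eq_iff_nonneg right_minus_eq zero_le_power2 power2_less_eq_zero_iff)
    with q \<open>x \<notin> ball 0 1\<close> show False by simp
  qed
  have "ball_H q d = cball (q /\<^sub>R (1 + k)) (sqrt s2)"
    using dist_H_le_iff[OF q _ d] complete_square in_ball
    by (auto simp: ball_H_def k_def)
  then show ?thesis by blast
qed

text \<open>The description in \<open>euclidean_center_H\<close> is well defined: the ball contains
  \<open>q\<close>, and a nonempty closed ball has only one center.\<close>

lemma ball_H_eq_cball_euclidean_center:
  fixes q :: "'a::euclidean_space"
  assumes q: "q \<in> ball 0 1" and d: "0 \<le> d"
  shows "\<exists>s. ball_H q d = cball (euclidean_center_H q d) s"
proof -
  obtain z s where zs: "ball_H q d = cball z s"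
    using ball_H_eq_cball[OF assms] by blast
  have "q \<in> ball_H q d"
    using q d by (simp add: ball_H_def)
  then have "\<exists>!z. \<exists>s. ball_H q d = cball z s"
    using zs by (metis cball_eq_cball_iff cball_eq_empty empty_iff not_less)
  then show ?thesis
    unfolding euclidean_center_H_def by (rule theI')
qed

section \<open>Validity of the initial lower bound\<close>

lemma norm_scaleR_self_shift:
  fixes q :: "'a::real_normed_vector"
  assumes "q \<noteq> 0"
  shows "norm ((1 - r / norm q) *\<^sub>R q) = \<bar>norm q - r\<bar>"
proof -
  have "norm ((1 - r / norm q) *\<^sub>R q) = \<bar>(1 - r / norm q) * norm q\<bar>"
    by (simp add: abs_mult)
  then show ?thesis
    using assms by (simp add: field_simps)
qed

text \<open>At fixed Euclidean distance \<open>t\<close> from \<open>q\<close>, the hyperbolic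
  distance is least when \<open>norm x\<close> is least, and \<open>norm x\<close> is at least
  \<open>\<bar>a - t\<bar>\<close>. The resulting minimum does not decrease as \<open>t\<close>
  grows from \<open>r\<close>.\<close>

lemma dist_H_lower_bound:
  fixes q x :: "'a::euclidean_space"
  assumes q: "q \<in> ball 0 1" and "q \<noteq> 0" and x: "x \<in> ball 0 1"
    and "0 \<le> r" and r: "r \<le> norm (x - q)"
  shows "dist_H q ((1 - r / norm q) *\<^sub>R q) \<le> dist_H q x"
proof -
  define a where "a = norm q"
  define t where "t = norm (x - q)"
  define p where "p = (1 - r / norm q) *\<^sub>R q"
  have a: "0 < a" "a < 1"
    using q \<open>q \<noteq> 0\<close> by (auto simp: a_def)
  have t: "r \<le> t" "\<bar>a - t\<bar> \<le> norm x" "t < 1 + a"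
    using r x norm_triangle_ineq4[of x q] norm_triangle_ineq2[of q x]
      norm_triangle_ineq2[of "x - q" "- q"]
    by (auto simp: a_def t_def norm_minus_commute)
  have norm_p: "norm p = \<bar>a - r\<bar>"
    using norm_scaleR_self_shift[OF \<open>q \<noteq> 0\<close>] by (simp add: p_def a_def)
  \<comment> \<open>The shifted point may lie beyond the origin; \<open>r \<le> t < 1 + a\<close>
    still keeps it in the unit ball.\<close>
  have p: "p \<in> ball 0 1"
    using norm_p a t \<open>0 \<le> r\<close> by auto
  have "q - p = (r / norm q) *\<^sub>R q"
    by (simp add: p_def algebra_simps)
  then have norm_qp: "norm (q - p) = r"
    using a \<open>0 \<le> r\<close> by (simp add: a_def)
  \<comment> \<open>This is the difference of the two sides of \<open>key\<close>; the terms
    \<open>r\<^sup>2 * t\<^sup>2\<close> cancel.\<close>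
  have "0 \<le> (1 - a\<^sup>2) * (t\<^sup>2 - r\<^sup>2) + 2 * a * t * r * (t - r)"
    using a t(1) \<open>0 \<le> r\<close> by (intro add_nonneg_nonneg mult_nonneg_nonneg) (auto simp: power_le_one)
  then have key: "r\<^sup>2 * (1 - (a - t)\<^sup>2) \<le> t\<^sup>2 * (1 - (a - r)\<^sup>2)"
    by (simp add: power2_eq_square algebra_simps)
  have "r\<^sup>2 * (1 - (norm x)\<^sup>2) \<le> r\<^sup>2 * (1 - (a - t)\<^sup>2)"
    using t(2) abs_le_square_iff[of "a - t" "norm x"] by (intro mult_left_mono) auto
  with key have "r\<^sup>2 * (1 - (norm x)\<^sup>2) \<le> t\<^sup>2 * (1 - (norm p)\<^sup>2)"
    by (simp add: norm_p)
  then have "r\<^sup>2 / (1 - (norm p)\<^sup>2) \<le> t\<^sup>2 / (1 - (norm x)\<^sup>2)"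
    using one_minus_norm_sq_pos[OF p] one_minus_norm_sq_pos[OF x] by (simp add: field_simps)
  then have "2 / (1 - (norm q)\<^sup>2) * (r\<^sup>2 / (1 - (norm p)\<^sup>2))
      \<le> 2 / (1 - (norm q)\<^sup>2) * (t\<^sup>2 / (1 - (norm x)\<^sup>2))"
    using one_minus_norm_sq_pos[OF q] by (intro mult_left_mono) auto
  then have "dist_H q p \<le> dist_H q x"
    unfolding dist_H_def
    by (intro arcosh_le_arcosh dist_H_arg_ge_1 p q)
      (simp add: norm_qp t_def norm_minus_commute[of q x])
  then show ?thesis by (simp add: p_def)
qed

section \<open>Invariant, termination and cost of the search\<close>

lemma ln_ratio_halves:
  fixes L R L' R' :: real
  assumes "0 < L" "0 < R" "0 < L'" "0 < R'" and "R' / L' \<le> sqrt (R / L)"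
  shows "2 * ln (R' / L') \<le> ln (R / L)"
proof -
  have "ln (R' / L') \<le> ln (sqrt (R / L))"
    using assms by simp
  then show ?thesis
    using assms by (simp add: ln_sqrt)
qed

context
  fixes D :: "'a::euclidean_space set" and q :: 'a and c :: real
    and orc :: "'a nn_oracle" and T S a w :: nat
  assumes D: "finite D" "D \<subseteq> ball 0 1" and q: "q \<in> ball 0 1" and c: "c > 1"
    and orc: "exact_euclidean_nn_oracle orc D T S"
begin

lemma answer_in: "answer orc z D \<in> D"
  and answer_nearest: "p \<in> D \<Longrightarrow> dist z (answer orc z D) \<le> dist z p"
  and query_time_le: "query_time orc z D \<le> T"
  and query_storage_le: "query_storage orc z D \<le> S"
  using orc by (auto simp: exact_euclidean_nn_oracle_def)

text \<open>The hyperbolic ball is a Euclidean ball about the queried point, so if the Euclidean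
  nearest data point lies outside it, every data point does.\<close>

lemma answer_outside_ball_H:
  assumes d: "0 \<le> d" and far: "d < dist_H (answer orc (euclidean_center_H q d) D) q" and "x \<in> D"
  shows "d \<le> dist_H x q"
proof -
  obtain s where s: "ball_H q d = cball (euclidean_center_H q d) s"
    using ball_H_eq_cball_euclidean_center[OF q d] by blast
  have "answer orc (euclidean_center_H q d) D \<notin> ball_H q d"
    using far by (simp add: ball_H_def dist_H_commute)
  then have "x \<notin> ball_H q d"
    using answer_nearest[OF \<open>x \<in> D\<close>, of "euclidean_center_H q d"] by (auto simp: s)
  then show ?thesis
    using D(2) \<open>x \<in> D\<close> by (auto simp: ball_H_def dist_H_commute)
qed

text \<open>The clause with \<open>2 ^ rounds s\<close> records the repeated halving of the
  logarithm. The factor \<open>1 + rounds s\<close> in the time clause includes the query made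
  before the loop.\<close>

definition search_invariant :: "'a search_state \<Rightarrow> bool" where
  "search_invariant s \<longleftrightarrow>
     best s \<in> D \<and> upper s = dist_H (best s) q \<and>
     0 < lower s \<and> (\<forall>x\<in>D. lower s \<le> dist_H x q) \<and>
     2 ^ rounds s * ln (upper s / lower s) \<le> ln (R_initial orc q D / L_initial orc q D) \<and>
     rounds s \<le> round_bound orc c q D \<and>
     time s \<le> (T + a) * (1 + rounds s) \<and> storage s \<le> S + w"

lemma search_invariant_init:
  assumes "answer orc q D \<noteq> q" and L: "L_initial orc q D \<noteq> 0"
  shows "search_invariant (search_init orc a w q D)"
proof -
  \<comment> \<open>For \<open>q = 0\<close> the formula for \<open>L_initial\<close> degenerates to
    \<open>dist_H 0 0 = 0\<close>.\<close>
  have "q \<noteq> 0"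
    using L by (auto simp: L_initial_def)
  have bound: "L_initial orc q D \<le> dist_H x q" if "x \<in> D" for x
    using dist_H_lower_bound[OF q \<open>q \<noteq> 0\<close>, of x "norm (answer orc q D - q)"]
      D(2) that answer_nearest[OF that, of q]
    by (auto simp: L_initial_def dist_H_commute[of x] dist_norm norm_minus_commute)
  \<comment> \<open>\<open>dist_H_nonneg\<close> applies only inside the unit ball, so the shifted
    point is first placed there by the triangle inequality.\<close>
  have "0 \<le> L_initial orc q D"
  proof -
    define p where "p = (1 - norm (answer orc q D - q) / norm q) *\<^sub>R q"
    have "norm p = \<bar>norm q - norm (answer orc q D - q)\<bar>"
      using norm_scaleR_self_shift[OF \<open>q \<noteq> 0\<close>] by (simp add: p_def)
    moreover have "norm q < 1" "norm (answer orc q D) < 1"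
      using q D(2) answer_in[of q] by auto
    ultimately have "p \<in> ball 0 1"
      using norm_triangle_ineq4[of "answer orc q D" q] norm_ge_zero[of "answer orc q D - q"]
      by (simp only: mem_ball_0)
    then show ?thesis
      using dist_H_nonneg[OF q] by (simp add: L_initial_def p_def)
  qed
  with L have "0 < L_initial orc q D" by simp
  then show ?thesis
    using bound answer_in[of q] query_time_le[of q] query_storage_le[of q]
    by (simp add: search_invariant_def search_init_def R_initial_def)
qed

text \<open>While the loop runs, the current ratio exceeds \<open>c\<close>, so the halving clause
  bounds \<open>2 ^ rounds s\<close> strictly. Strictness leaves space for one more round and gives
  the termination measure.\<close>

lemma rounds_less_round_bound:
  assumes "search_invariant s" and "answer orc q D \<noteq> q" and "c * lower s < upper s"
  shows "rounds s < round_bound orc c q D"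
proof -
  let ?Q = "ln (R_initial orc q D / L_initial orc q D)"
  have L: "0 < lower s" and inv: "2 ^ rounds s * ln (upper s / lower s) \<le> ?Q"
    using assms(1) by (auto simp: search_invariant_def)
  have "c < upper s / lower s"
    using assms(3) L by (simp add: field_simps)
  then have "ln c < ln (upper s / lower s)"
    using c by simp
  then have "2 ^ rounds s * ln c < ?Q"
    using inv by (smt (verit) mult_less_cancel_left_pos zero_less_power)
  then have *: "2 ^ rounds s < ?Q / ln c"
    using c by (simp add: field_simps)
  then have "real (rounds s) < log 2 (?Q / ln c)"
    by (smt (verit, best) less_log_of_power zero_less_power)
  then show ?thesis
    using assms(2) unfolding round_bound_def by simp linarith
qed

lemma search_invariant_round:
  assumes inv: "search_invariant s" and "answer orc q D \<noteq> q" and cont: "c * lower s < upper s"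
  shows "search_invariant (search_round orc a w q D s)"
proof -
  define d where "d = sqrt (upper s * lower s)"
  define z where "z = euclidean_center_H q d"
  define n where "n = answer orc z D"
  have L: "0 < lower s" and lower: "\<And>x. x \<in> D \<Longrightarrow> lower s \<le> dist_H x q"
    and halving: "2 ^ rounds s * ln (upper s / lower s) \<le> ln (R_initial orc q D / L_initial orc q D)"
    using inv by (auto simp: search_invariant_def)
  \<comment> \<open>\<open>upper s\<close> is the distance of a data point, hence at least
    \<open>lower s\<close>.\<close>
  have R: "0 < upper s"
    using inv lower[of "best s"] by (auto simp: search_invariant_def)
  have d: "0 < d" using L R by (simp add: d_def)
  have n: "n \<in> D" "0 < dist_H n q"
    using answer_in lower[of n] L by (force simp: n_def)+
  have rounds: "Suc (rounds s) \<le> round_bound orc c q D"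
    using rounds_less_round_bound[OF assms] by simp
  have time: "time s + query_time orc z D + a \<le> (T + a) * (1 + Suc (rounds s))"
    using inv query_time_le[of z] by (simp add: search_invariant_def algebra_simps)
  have storage: "max (storage s) (query_storage orc z D + w) \<le> S + w"
    using inv query_storage_le[of z] by (simp add: search_invariant_def)
  \<comment> \<open>Stated for arbitrary new bounds because the two branches change different
    ones.\<close>
  have step: "2 ^ Suc (rounds s) * ln (R' / L') \<le> ln (R_initial orc q D / L_initial orc q D)"
    if "0 < R'" "0 < L'" "R' / L' \<le> sqrt (upper s / lower s)" for R' L'
  proof -
    have "2 ^ rounds s * (2 * ln (R' / L')) \<le> 2 ^ rounds s * ln (upper s / lower s)"
      by (intro mult_left_mono ln_ratio_halves L R that) simp
    with halving show ?thesis by (simp only: power_Suc mult_ac)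
  qed
  \<comment> \<open>The geometric mean makes both ratios equal, so either outcome halves the
    logarithm. A new \<open>upper\<close> may even fall below \<open>d\<close>, hence the inequality
    in \<open>step\<close>.\<close>
  have ratios: "upper s / d = sqrt (upper s / lower s)" "d / lower s = sqrt (upper s / lower s)"
    using L R by (simp_all add: d_def real_sqrt_mult real_sqrt_divide field_simps)
  show ?thesis
  proof (cases "d < dist_H n q")
    case True
    have "search_round orc a w q D s = s\<lparr>lower := d, rounds := rounds s + 1,
        time := time s + query_time orc z D + a,
        storage := max (storage s) (query_storage orc z D + w)\<rparr>"
      using True by (simp add: search_round_def Let_def d_def z_def n_def)
    then show ?thesis
      using inv d rounds time storage step[OF R d] ratios(1)
        answer_outside_ball_H[of d] True
      by (simp add: search_invariant_def n_def z_def)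
  next
    case False
    have "search_round orc a w q D s = s\<lparr>upper := dist_H n q, best := n, rounds := rounds s + 1,
        time := time s + query_time orc z D + a,
        storage := max (storage s) (query_storage orc z D + w)\<rparr>"
      using False by (simp add: search_round_def Let_def d_def z_def n_def)
    moreover have "dist_H n q / lower s \<le> sqrt (upper s / lower s)"
      using False L by (simp add: ratios(2)[symmetric] divide_right_mono)
    ultimately show ?thesis
      using inv n L lower rounds time storage step[OF n(2) L]
      by (simp add: search_invariant_def)
  qed
qed

lemma ex_hyperbolic_nn: "\<exists>p. hyperbolic_nn q D p"
proof -
  have "D \<noteq> {}" using answer_in by blast
  then show ?thesis
    using D(1) ex_min_if_finite[of "(\<lambda>x. dist_H x q) ` D"]
    by (fastforce simp: hyperbolic_nn_def not_less)
qed

text \<open>On exit \<open>upper s \<le> c * lower s\<close>, and \<open>lower s\<close> bounds the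
  optimal distance from below, so \<open>best s\<close> is within the factor
  \<open>c\<close>.\<close>

lemma binary_search_correct:
  assumes nz: "answer orc q D \<noteq> q \<Longrightarrow> R_initial orc q D \<noteq> 0 \<and> L_initial orc q D \<noteq> 0"
  shows "\<exists>s. binary_search_hyperbolic_nn orc a w c q D = Some s \<and>
             approx_hyperbolic_nn c q D (best s) \<and>
             rounds s \<le> round_bound orc c q D \<and>
             time s \<le> (T + a) * (1 + round_bound orc c q D) \<and>
             storage s \<le> S + w"
proof (cases "answer orc q D = q")
  case True
  then have "q \<in> D"
    using answer_in by metis
  moreover have "hyperbolic_nn q D q"
    using \<open>q \<in> D\<close> dist_H_nonneg[OF subsetD[OF D(2)] q] by (simp add: hyperbolic_nn_def)
  ultimately show ?thesis
    using True query_time_le[of q] query_storage_le[of q]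
    by (auto simp: binary_search_hyperbolic_nn_def search_init_def round_bound_def
        approx_hyperbolic_nn_def)
next
  case False
  let ?s0 = "search_init orc a w q D" and ?b = "\<lambda>s. upper s > c * lower s"
  have init: "search_invariant ?s0"
    using search_invariant_init nz False by blast
  obtain s where s: "while_option ?b (search_round orc a w q D) ?s0 = Some s"
  proof -
    \<comment> \<open>The measure \<open>round_bound orc c q D - rounds s\<close> strictly decreases
      because the truncated difference is positive whenever the loop test holds.\<close>
    have "rounds (search_round orc a w q D s) = Suc (rounds s)" for s
      by (simp add: search_round_def Let_def)
    then show ?thesis
      using measure_while_option_Some[of search_invariant ?b "search_round orc a w q D"
          "\<lambda>s. round_bound orc c q D - rounds s", OF _ init]
        search_invariant_round rounds_less_round_bound False that
      by (metis diff_less_mono2 lessI)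
  qed
  have inv: "search_invariant s"
    using while_option_rule[of search_invariant, OF _ s init] search_invariant_round False by blast
  have stop: "upper s \<le> c * lower s"
    using while_option_stop[OF s] by simp
  obtain p where p: "hyperbolic_nn q D p"
    using ex_hyperbolic_nn by blast
  have "dist_H (best s) q \<le> c * dist_H p q"
  proof -
    have "c * lower s \<le> c * dist_H p q"
      using inv p c by (intro mult_left_mono) (auto simp: search_invariant_def hyperbolic_nn_def)
    then show ?thesis
      using stop inv by (simp add: search_invariant_def)
  qed
  then have "approx_hyperbolic_nn c q D (best s)"
    using inv p by (auto simp: approx_hyperbolic_nn_def search_invariant_def)
  moreover have "time s \<le> (T + a) * (1 + round_bound orc c q D)"
    using inv by (auto simp: search_invariant_def intro: order_trans mult_le_mono2)
  ultimately show ?thesis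
    using s inv False
    by (auto simp: binary_search_hyperbolic_nn_def search_invariant_def search_init_def)
qed

end

theorem theorem2:
  fixes D :: "'a::euclidean_space set" and q :: 'a and c :: real
    and orc :: "'a nn_oracle" and T S a w :: nat
  assumes "finite D" and "D \<subseteq> ball 0 1" and "q \<in> ball 0 1" and "c > 1"
    and "exact_euclidean_nn_oracle orc D T S"
    and "answer orc q D \<noteq> q \<Longrightarrow> R_initial orc q D \<noteq> 0 \<and> L_initial orc q D \<noteq> 0"
  shows "\<exists>s. binary_search_hyperbolic_nn orc a w c q D = Some s \<and>
             approx_hyperbolic_nn c q D (best s) \<and>
             rounds s \<le> round_bound orc c q D \<and>
             time s \<le> (T + a) * (1 + round_bound orc c q D) \<and>
             storage s \<le> S + w"
  using assms by (rule binary_search_correct)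

end
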